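(* Let $\mathbf{H}\in\mathbb{R}^{3\times 3}$ be symmetric positive definite, $\mathbf{b}\in\mathbb{R}^3$, $f(\mathbf{x})=\frac12\mathbf{x}^T\mathbf{H}\mathbf{x}+\mathbf{b}^T\mathbf{x}$, and let $\mathbf{x}^*$ be the minimizer of $f$ on $\mathbb{R}^3$. Let $\mathbf{x}_0\in\mathbb{R}^3$, write $\mathbf{g}_k=\nabla f(\mathbf{x}_k)$, and let $\mathbf{x}_1=\mathbf{x}_0-\alpha_0^{SD}\mathbf{g}_0$, $\mathbf{x}_2=\mathbf{x}_1-\alpha_1^{SD}\mathbf{g}_1$, where $\mathbf{g}_0,\mathbf{g}_1,\mathbf{g}_2$ are assumed linearly independent. Let $\alpha^{NY(1)},\alpha^{NY(2)},\alpha^{NY(3)}$ be the three stepsizes defined in the context. For distinct $i,j\in\{1,2,3\}$ put $$\mathbf{x}_3=\mathbf{x}_2-\alpha^{NY(i)}\mathbf{g}_2,\qquad \mathbf{x}_4=\mathbf{x}_3-\alpha^{NY(j)}\mathbf{g}_3 .$$ Then either $\mathbf{g}_4=\mathbf{0}$ (so that $\mathbf{x}_4=\mathbf{x}^*$), or $\mathbf{x}_4-\alpha_4^{SD}\mathbf{g}_4=\mathbf{x}^*$. That is, the gradient method reaches the optimal solution in at most $5$ steps.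
   Context: The norm is Euclidean. For $\mathbf{g}_k\neq\mathbf{0}$ the Cauchy (exact line search) stepsize is $\alpha_k^{SD}=\frac{\mathbf{g}_k^T\mathbf{g}_k}{\mathbf{g}_k^T\mathbf{H}\mathbf{g}_k}$. Define $$\beta=\frac{\|\mathbf{g}_2\|^2}{(\alpha_1^{SD})^2\|\mathbf{g}_1\|^2},\quad \gamma=\frac{(\mathbf{g}_2^T\mathbf{g}_0)^2}{\|\mathbf{g}_0\|^2\|\mathbf{g}_2\|^2},\quad a_{33}=\frac{\frac{1}{\alpha_2^{SD}}-\frac{1}{\alpha_0^{SD}}\gamma}{1-\gamma},$$ $$t_1=\frac{1}{\alpha_0^{SD}}+\frac{1}{\alpha_1^{SD}}+a_{33},\quad t_2=\frac{1}{\alpha_0^{SD}\alpha_1^{SD}}+\Big(\frac{1}{\alpha_0^{SD}}+\frac{1}{\alpha_1^{SD}}\Big)a_{33}-\beta,\quad t_3=\frac{a_{33}}{\alpha_0^{SD}\alpha_1^{SD}}-\frac{1}{\alpha_0^{SD}}\beta(1-\gamma)-a_{33}\beta\gamma,$$ $$p=t_2-\frac{t_1^2}{3},\quad q=-\frac{2t_1^3}{27}+\frac{t_1t_2}{3}-t_3,\quad \phi=\frac13\arccos\Big(\frac{3q}{2p}\sqrt{\frac{-3}{p}}\Big),$$ $$\mu_1=\frac{t_1}{3}+2\sqrt{-\frac p3}\cos\phi,\quad \mu_2=\frac{t_1}{3}+2\sqrt{-\frac p3}\cos\Big(\phi-\frac{2\pi}{3}\Big),\quad \mu_3=\frac{t_1}{3}+2\sqrt{-\frac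 p3}\cos\Big(\phi+\frac{2\pi}{3}\Big),$$ the three roots of $\mu^3-t_1\mu^2+t_2\mu-t_3=0$. The stepsizes are $\alpha^{NY(i)}=\mu_i^{-1}$, $i=1,2,3$. *)

theory Defs
  imports "HOL-Analysis.Analysis"
begin

definition sym_pos_def :: "real ^ 'n ^ 'n \<Rightarrow> bool" where
  "sym_pos_def H \<longleftrightarrow> transpose H = H \<and> (\<forall>v. v \<noteq> 0 \<longrightarrow> v \<bullet> (H *v v) > 0)"

definition quad :: "real ^ 'n ^ 'n \<Rightarrow> real ^ 'n \<Rightarrow> real ^ 'n \<Rightarrow> real" where
  "quad H b x = 1 / 2 * (x \<bullet> (H *v x)) + b \<bullet> x"

definition grad :: "('a::real_inner \<Rightarrow> real) \<Rightarrow> 'a \<Rightarrow> 'a" where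
  "grad f x = (THE D. GDERIV f x :> D)"

lemma grad_eqI:
  assumes "GDERIV f x :> D"
  shows "grad f x = D"
  unfolding grad_def
proof (rule the_equality)
  show "GDERIV f x :> D" by fact
  fix E assume "GDERIV f x :> E"
  with assms have "(\<lambda>h. h \<bullet> E) = (\<lambda>h. h \<bullet> D)"
    unfolding gderiv_def by (rule has_derivative_unique[rotated])
  then have "(E - D) \<bullet> (E - D) = 0"
    by (metis inner_diff_right right_minus_eq)
  then show "E = D" by simp
qed

lemma grad_quad:
  assumes "transpose H = H"
  shows "grad (quad H b) x = H *v x + b"
proof (rule grad_eqI)
  have sym: "x \<bullet> (H *v h) = h \<bullet> (H *v x)" for h
    by (metis assms dot_lmul_matrix inner_commute transpose_matrix_vector)
  have lin: "((\<lambda>y. H *v y) has_derivative (\<lambda>h. H *v h)) (at x)"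
    by (intro bounded_linear_imp_has_derivative matrix_vector_mul_bounded_linear)
  have "(quad H b has_derivative
      (\<lambda>h. 1 / 2 * (x \<bullet> (H *v h) + h \<bullet> (H *v x)) + b \<bullet> h)) (at x)"
    unfolding quad_def[abs_def] by (intro derivative_intros lin)
  then show "GDERIV (quad H b) x :> H *v x + b"
    unfolding gderiv_def by (simp add: sym inner_add_right inner_commute[of b])
qed

text \<open>In the following formulas division by zero has the value 0 by convention. When a
  3 by 3 matrix is symmetric positive definite and the arguments \<open>g0\<close>, \<open>g1\<close>, \<open>g2\<close> are linearly
  independent gradients at successive exact line search iterates, every denominator is nonzero
  (in particular \<open>p\<close> is negative and \<open>\<gamma>\<close> differs from 1).\<close>

definition sd_step :: "real ^ 'n ^ 'n \<Rightarrow> real ^ 'n \<Rightarrow> real" where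
  "sd_step H g = (g \<bullet> g) / (g \<bullet> (H *v g))"

definition ny_beta :: "real ^ 'n ^ 'n \<Rightarrow> real ^ 'n \<Rightarrow> real ^ 'n \<Rightarrow> real" where
  "ny_beta H g1 g2 = (norm g2)\<^sup>2 / ((sd_step H g1)\<^sup>2 * (norm g1)\<^sup>2)"

definition ny_gamma :: "real ^ 'n \<Rightarrow> real ^ 'n \<Rightarrow> real" where
  "ny_gamma g0 g2 = (g2 \<bullet> g0)\<^sup>2 / ((norm g0)\<^sup>2 * (norm g2)\<^sup>2)"

definition ny_a33 :: "real ^ 'n ^ 'n \<Rightarrow> real ^ 'n \<Rightarrow> real ^ 'n \<Rightarrow> real" where
  "ny_a33 H g0 g2 =
     (1 / sd_step H g2 - 1 / sd_step H g0 * ny_gamma g0 g2) / (1 - ny_gamma g0 g2)"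

definition ny_t1 :: "real ^ 'n ^ 'n \<Rightarrow> real ^ 'n \<Rightarrow> real ^ 'n \<Rightarrow> real ^ 'n \<Rightarrow> real" where
  "ny_t1 H g0 g1 g2 = 1 / sd_step H g0 + 1 / sd_step H g1 + ny_a33 H g0 g2"

definition ny_t2 :: "real ^ 'n ^ 'n \<Rightarrow> real ^ 'n \<Rightarrow> real ^ 'n \<Rightarrow> real ^ 'n \<Rightarrow> real" where
  "ny_t2 H g0 g1 g2 =
     1 / (sd_step H g0 * sd_step H g1)
     + (1 / sd_step H g0 + 1 / sd_step H g1) * ny_a33 H g0 g2
     - ny_beta H g1 g2"

definition ny_t3 :: "real ^ 'n ^ 'n \<Rightarrow> real ^ 'n \<Rightarrow> real ^ 'n \<Rightarrow> real ^ 'n \<Rightarrow> real" where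
  "ny_t3 H g0 g1 g2 =
     ny_a33 H g0 g2 / (sd_step H g0 * sd_step H g1)
     - 1 / sd_step H g0 * ny_beta H g1 g2 * (1 - ny_gamma g0 g2)
     - ny_a33 H g0 g2 * ny_beta H g1 g2 * ny_gamma g0 g2"

definition ny_p :: "real ^ 'n ^ 'n \<Rightarrow> real ^ 'n \<Rightarrow> real ^ 'n \<Rightarrow> real ^ 'n \<Rightarrow> real" where
  "ny_p H g0 g1 g2 = ny_t2 H g0 g1 g2 - (ny_t1 H g0 g1 g2)\<^sup>2 / 3"

definition ny_q :: "real ^ 'n ^ 'n \<Rightarrow> real ^ 'n \<Rightarrow> real ^ 'n \<Rightarrow> real ^ 'n \<Rightarrow> real" where
  "ny_q H g0 g1 g2 =
     - (2 * ny_t1 H g0 g1 g2 ^ 3 / 27)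
     + ny_t1 H g0 g1 g2 * ny_t2 H g0 g1 g2 / 3
     - ny_t3 H g0 g1 g2"

definition ny_phi :: "real ^ 'n ^ 'n \<Rightarrow> real ^ 'n \<Rightarrow> real ^ 'n \<Rightarrow> real ^ 'n \<Rightarrow> real" where
  "ny_phi H g0 g1 g2 =
     1 / 3 * arccos (3 * ny_q H g0 g1 g2 / (2 * ny_p H g0 g1 g2) * sqrt (- 3 / ny_p H g0 g1 g2))"

text \<open>Only the indices 1, 2, 3 are meaningful.\<close>

definition ny_mu ::
    "real ^ 'n ^ 'n \<Rightarrow> real ^ 'n \<Rightarrow> real ^ 'n \<Rightarrow> real ^ 'n \<Rightarrow> nat \<Rightarrow> real" where
  "ny_mu H g0 g1 g2 i =
     ny_t1 H g0 g1 g2 / 3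
     + 2 * sqrt (- ny_p H g0 g1 g2 / 3)
       * cos (if i = 1 then ny_phi H g0 g1 g2
              else if i = 2 then ny_phi H g0 g1 g2 - 2 * pi / 3
              else ny_phi H g0 g1 g2 + 2 * pi / 3)"

definition ny_step ::
    "real ^ 'n ^ 'n \<Rightarrow> real ^ 'n \<Rightarrow> real ^ 'n \<Rightarrow> real ^ 'n \<Rightarrow> nat \<Rightarrow> real" where
  "ny_step H g0 g1 g2 i = inverse (ny_mu H g0 g1 g2 i)"

end

theory Submission
  imports Defs
begin

text \<open>With \<open>w\<close> the component of \<open>g2\<close> orthogonal to \<open>g0\<close>, the vectors \<open>g0\<close>, \<open>g1\<close>, \<open>w\<close> are an
  orthogonal basis in which \<open>H\<close> is tridiagonal, and \<open>\<mu>\<^sup>3 - t1 \<mu>\<^sup>2 + t2 \<mu> - t3\<close> is the characteristic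
  polynomial of \<open>H\<close>. A step of length \<open>1 / \<mu>\<close> maps a gradient \<open>g\<close> to a multiple of \<open>(H - \<mu>) g\<close>, so
  by Cayley--Hamilton \<open>g4\<close> is zero or an eigenvector for the remaining root, and then one exact
  line search reaches the minimizer. The trigonometric formula does give the roots because a
  Jacobi cubic has only real ones; repeated roots need no separate treatment.\<close>

section \<open>Jacobi cubics have only real roots\<close>

text \<open>Dividing out the root \<open>l\<close> leaves the monic quadratic in the second
  hypothesis. A nonpositive value forces its discriminant \<open>- 3 * l\<^sup>2 - 4 * p\<close> to
  be nonnegative; the discriminant of the cubic is this number times the squared value
  \<open>3 * l\<^sup>2 + p\<close> of the quadratic at \<open>l\<close>.\<close>

lemma cubic_discriminant_nonneg:
  fixes l p q y :: real
  assumes root: "l ^ 3 + p * l + q = 0" and neg: "y\<^sup>2 + l * y + (p + l\<^sup>2) \<le> 0"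
  shows "27 * q\<^sup>2 \<le> - 4 * p ^ 3"
proof -
  have "- 3 * l\<^sup>2 - 4 * p = (2 * y + l)\<^sup>2 + 4 * (- (y\<^sup>2 + l * y + (p + l\<^sup>2)))"
    by algebra
  also have "0 \<le> \<dots>"
    using neg by (intro add_nonneg_nonneg) simp_all
  finally have "0 \<le> - 3 * l\<^sup>2 - 4 * p" .
  then have "0 \<le> (- 3 * l\<^sup>2 - 4 * p) * (3 * l\<^sup>2 + p)\<^sup>2"
    by simp
  also have "\<dots> = - 4 * p ^ 3 - 27 * q\<^sup>2"
    using root by algebra
  finally show ?thesis by simp
qed

text \<open>The characteristic polynomial of a symmetric tridiagonal matrix with diagonal \<open>a, b, c\<close>
  and squared off-diagonal entries \<open>r\<close> (next to \<open>a\<close>) and \<open>s\<close> (next to \<open>c\<close>).\<close>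

definition jacobi_cubic :: "real \<Rightarrow> real \<Rightarrow> real \<Rightarrow> real \<Rightarrow> real \<Rightarrow> real \<Rightarrow> real" where
  "jacobi_cubic a b c r s x = (x - a) * ((x - b) * (x - c) - s) - r * (x - c)"

text \<open>The cubic changes sign between \<open>a\<close> and \<open>c\<close>, in the direction opposite to its growth at
  infinity; the cofactor of a root \<open>l\<close> lying between them is therefore nonpositive at one of them.\<close>

lemma jacobi_cubic_root:
  fixes a b c r s :: real
  assumes "0 \<le> r" "0 \<le> s"
  obtains l y where "jacobi_cubic a b c r s l = 0"
    and "y\<^sup>2 + (l - (a + b + c)) * y
      + (l\<^sup>2 - (a + b + c) * l + (a * b + a * c + b * c - r - s)) \<le> 0"
proof -
  define f where "f = jacobi_cubic a b c r s"
  define Q where "Q = (\<lambda>l y. y\<^sup>2 + (l - (a + b + c)) * y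
      + (l\<^sup>2 - (a + b + c) * l + (a * b + a * c + b * c - r - s)))"
  have factor: "f x = (x - l) * Q l x" if "f l = 0" for x l
    using that unfolding f_def Q_def jacobi_cubic_def by algebra
  have cont: "continuous_on S f" for S
    unfolding f_def jacobi_cubic_def[abs_def] by (intro continuous_intros)
  have fa: "f a = r * (c - a)" and fc: "f c = s * (a - c)"
    by (auto simp: f_def jacobi_cubic_def algebra_simps)
  have between: "\<exists>l y. f l = 0 \<and> Q l y \<le> 0"
    if "y < z" and fy: "0 \<le> f y" and fz: "f z \<le> 0" for y z
  proof -
    obtain l where l: "y \<le> l" "l \<le> z" "f l = 0"
      using IVT2'[OF fz fy less_imp_le[OF \<open>y < z\<close>] cont] by auto
    show ?thesis
    proof (cases "y < l")
      case True
      then have "Q l y \<le> 0"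
        using fy factor[OF l(3), of y] by (simp add: zero_le_mult_iff)
      then show ?thesis using l by blast
    next
      case False
      then have "l < z" using l \<open>y < z\<close> by simp
      then have "Q l z \<le> 0"
        using fz factor[OF l(3), of z] by (simp add: mult_le_0_iff)
      then show ?thesis using l by blast
    qed
  qed
  have "\<exists>l y. f l = 0 \<and> Q l y \<le> 0"
  proof (cases a c rule: linorder_cases)
    case less
    then show ?thesis
      using between[of a c] fa fc assms by (simp add: mult_nonneg_nonpos)
  next
    case equal
    \<comment> \<open>Here \<open>f a = 0\<close>, so \<open>a\<close> serves both as the root and
      as the test point.\<close>
    have "Q a a = - (r + s)"
      using equal by (simp add: Q_def power2_eq_square algebra_simps)
    then show ?thesis
      using equal fa assms by (intro exI[of _ a]) simp
  next
    case greater
    then show ?thesis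
      using between[of c a] fa fc assms by (simp add: mult_nonneg_nonpos)
  qed
  then show ?thesis
    using that unfolding f_def Q_def by blast
qed

section \<open>Trigonometric solution of the cubic\<close>

text \<open>These are the Vieta relations of \<open>4 * x ^ 3 - 3 * x = cos (3 * \<phi>)\<close>,
  the triple-angle equation for \<open>x = cos \<phi>\<close>.\<close>

lemma sum_cos_thirds:
  fixes \<phi> :: real
  shows "cos \<phi> + cos (\<phi> - 2 * pi / 3) + cos (\<phi> + 2 * pi / 3) = 0" (is ?sum)
    and "cos \<phi> * cos (\<phi> - 2 * pi / 3) + cos \<phi> * cos (\<phi> + 2 * pi / 3)
      + cos (\<phi> - 2 * pi / 3) * cos (\<phi> + 2 * pi / 3) = - 3 / 4" (is ?pairs)
    and "4 * (cos \<phi> * cos (\<phi> - 2 * pi / 3) * cos (\<phi> + 2 * pi / 3)) = cos (3 * \<phi>)" (is ?prod)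
proof -
  define C S where "C = cos \<phi>" and "S = sin \<phi>"
  have minus: "cos (\<phi> - 2 * pi / 3) = - C / 2 + sqrt 3 / 2 * S"
    and plus: "cos (\<phi> + 2 * pi / 3) = - C / 2 - sqrt 3 / 2 * S"
    using cos_120 sin_120 by (simp_all add: cos_diff cos_add C_def S_def)
  have "(- C / 2 + sqrt 3 / 2 * S) * (- C / 2 - sqrt 3 / 2 * S) = C\<^sup>2 / 4 - 3 / 4 * S\<^sup>2"
    by (simp add: field_simps power2_eq_square)
  also have "\<dots> = C\<^sup>2 - 3 / 4"
    by (simp add: C_def S_def sin_squared_eq field_simps)
  finally have minus_plus: "cos (\<phi> - 2 * pi / 3) * cos (\<phi> + 2 * pi / 3) = C\<^sup>2 - 3 / 4"
    by (simp only: minus plus)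
  show ?sum by (simp add: minus plus C_def)
  show ?pairs
    unfolding minus_plus unfolding minus plus C_def[symmetric]
    by (simp add: power2_eq_square algebra_simps)
  show ?prod
    unfolding mult.assoc minus_plus cos_treble_cos C_def[symmetric]
    by (simp add: power2_eq_square power3_eq_cube algebra_simps)
qed

text \<open>Scaling by \<open>2 * sqrt (- p / 3)\<close> turns the cubic into the triple-angle
  equation; the discriminant bound says exactly that the argument of \<open>arccos\<close> lies in
  [-1, 1]. Vieta relations, unlike mere root equations, also record multiplicities.\<close>

lemma depressed_cubic_trig_roots:
  fixes p q :: real
  assumes p: "p < 0" and disc: "27 * q\<^sup>2 \<le> - 4 * p ^ 3"
  defines "\<phi> \<equiv> 1 / 3 * arccos (3 * q / (2 * p) * sqrt (- 3 / p))"
  defines "y1 \<equiv> 2 * sqrt (- p / 3) * cos \<phi>"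
    and "y2 \<equiv> 2 * sqrt (- p / 3) * cos (\<phi> - 2 * pi / 3)"
    and "y3 \<equiv> 2 * sqrt (- p / 3) * cos (\<phi> + 2 * pi / 3)"
  shows "y1 + y2 + y3 = 0" and "y1 * y2 + y1 * y3 + y2 * y3 = p" and "y1 * y2 * y3 = - q"
proof -
  define R where "R = sqrt (- p / 3)"
  define u where "u = 3 * q / (2 * p) * sqrt (- 3 / p)"
  have R2: "R\<^sup>2 = - p / 3" and R: "0 < R" using p by (simp_all add: R_def)
  have p_eq: "p = - 3 * R\<^sup>2" using R2 by simp
  have "sqrt (- 3 / p) = 1 / R"
    using R by (simp add: p_eq real_sqrt_divide)
  then have u: "u = - q / (2 * R ^ 3)"
    using R by (simp add: u_def p_eq field_simps power2_eq_square power3_eq_cube)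
  have "q\<^sup>2 \<le> (2 * R ^ 3)\<^sup>2"
    using disc by (simp add: p_eq power_mult_distrib flip: power_mult)
  then have "\<bar>q\<bar> \<le> 2 * R ^ 3"
    using R abs_le_square_iff[of q "2 * R ^ 3"] by simp
  then have "\<bar>u\<bar> \<le> 1"
    using R by (simp add: u abs_divide)
  moreover have "3 * \<phi> = arccos u"
    by (simp add: \<phi>_def u_def)
  ultimately have cos3: "cos (3 * \<phi>) = u"
    by (simp add: cos_arccos_abs)
  define c1 c2 c3
    where "c1 = cos \<phi>" and "c2 = cos (\<phi> - 2 * pi / 3)" and "c3 = cos (\<phi> + 2 * pi / 3)"
  note cs = sum_cos_thirds[of \<phi>, folded c1_def c2_def c3_def, unfolded cos3]
  have ys: "y1 = 2 * R * c1" "y2 = 2 * R * c2" "y3 = 2 * R * c3"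
    by (simp_all add: y1_def y2_def y3_def R_def c1_def c2_def c3_def)
  have "y1 + y2 + y3 = 2 * R * (c1 + c2 + c3)" by (simp add: ys algebra_simps)
  then show "y1 + y2 + y3 = 0" using cs(1) by simp
  have "y1 * y2 + y1 * y3 + y2 * y3 = 4 * R\<^sup>2 * (c1 * c2 + c1 * c3 + c2 * c3)"
    by (simp add: ys power2_eq_square algebra_simps)
  then show "y1 * y2 + y1 * y3 + y2 * y3 = p" using cs(2) R2 by simp
  have "y1 * y2 * y3 = 2 * R ^ 3 * (4 * (c1 * c2 * c3))"
    by (simp add: ys power3_eq_cube)
  then show "y1 * y2 * y3 = - q" using cs(3) R by (simp add: u)
qed

text \<open>The Tschirnhaus shift \<open>x = t1 / 3 + y\<close> turns the discriminant condition into one on the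
  depressed cubic.\<close>

lemma jacobi_cubic_trig_roots:
  fixes a b c r s :: real
  assumes "0 \<le> r" "0 \<le> s" "0 < r + s"
  defines "t1 \<equiv> a + b + c"
    and "t2 \<equiv> a * b + a * c + b * c - r - s"
    and "t3 \<equiv> a * b * c - a * s - c * r"
  defines "p \<equiv> t2 - t1\<^sup>2 / 3"
    and "q \<equiv> - (2 * t1 ^ 3 / 27) + t1 * t2 / 3 - t3"
  defines "\<phi> \<equiv> 1 / 3 * arccos (3 * q / (2 * p) * sqrt (- 3 / p))"
  defines "m1 \<equiv> t1 / 3 + 2 * sqrt (- p / 3) * cos \<phi>"
    and "m2 \<equiv> t1 / 3 + 2 * sqrt (- p / 3) * cos (\<phi> - 2 * pi / 3)"
    and "m3 \<equiv> t1 / 3 + 2 * sqrt (- p / 3) * cos (\<phi> + 2 * pi / 3)"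
  shows "m1 + m2 + m3 = t1" and "m1 * m2 + m1 * m3 + m2 * m3 = t2" and "m1 * m2 * m3 = t3"
proof -
  define X where "X = (a - b)\<^sup>2 + (b - c)\<^sup>2 + (a - c)\<^sup>2"
  have "0 \<le> X" by (simp add: X_def)
  \<comment> \<open>The assumption \<open>0 < r + s\<close> excludes \<open>p = 0\<close>, where the
    formula for \<open>\<phi>\<close> would divide by zero.\<close>
  moreover have "p = - X / 6 - (r + s)"
    unfolding p_def t1_def t2_def X_def by (simp add: power2_eq_square field_simps)
  ultimately have p: "p < 0"
    using \<open>0 < r + s\<close> by linarith
  obtain l y where l: "jacobi_cubic a b c r s l = 0"
    and y: "y\<^sup>2 + (l - (a + b + c)) * y
      + (l\<^sup>2 - (a + b + c) * l + (a * b + a * c + b * c - r - s)) \<le> 0"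
    using jacobi_cubic_root[OF assms(1,2)] by blast
  define h where "h = t1 / 3"
  have t1: "t1 = 3 * h" by (simp add: h_def)
  have p_eq: "p = t2 - 3 * h\<^sup>2" and q_eq: "q = - 2 * h ^ 3 + h * t2 - t3"
    by (simp_all add: p_def q_def t1 power_mult_distrib)
  have "l ^ 3 - t1 * l\<^sup>2 + t2 * l - t3 = 0"
    using l unfolding jacobi_cubic_def t1_def t2_def t3_def by algebra
  then have root: "(l - h) ^ 3 + p * (l - h) + q = 0"
    unfolding p_eq q_eq t1 by algebra
  have "y\<^sup>2 + (l - t1) * y + (l\<^sup>2 - t1 * l + t2) \<le> 0"
    using y unfolding t1_def t2_def .
  also have "y\<^sup>2 + (l - t1) * y + (l\<^sup>2 - t1 * l + t2)
      = (y - h)\<^sup>2 + (l - h) * (y - h) + (p + (l - h)\<^sup>2)"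
    unfolding p_eq t1 by algebra
  finally have disc: "27 * q\<^sup>2 \<le> - 4 * p ^ 3"
    using cubic_discriminant_nonneg[OF root] by blast
  define y1 y2 y3 where "y1 = 2 * sqrt (- p / 3) * cos \<phi>"
    and "y2 = 2 * sqrt (- p / 3) * cos (\<phi> - 2 * pi / 3)"
    and "y3 = 2 * sqrt (- p / 3) * cos (\<phi> + 2 * pi / 3)"
  note ys = depressed_cubic_trig_roots[OF p disc, folded \<phi>_def, folded y1_def y2_def y3_def]
  have ms: "m1 = h + y1" "m2 = h + y2" "m3 = h + y3"
    by (simp_all add: m1_def m2_def m3_def h_def y1_def y2_def y3_def)
  show "m1 + m2 + m3 = t1" using ys(1) by (simp add: ms t1)
  show "m1 * m2 + m1 * m3 + m2 * m3 = t2" using ys p_eq unfolding ms by algebra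
  show "m1 * m2 * m3 = t3" using ys p_eq q_eq unfolding ms by algebra
qed

section \<open>Quadratic objective and gradient steps\<close>

lemma inner_matrix_vector_commute:
  fixes H :: "real ^ 'n ^ 'n"
  assumes "transpose H = H"
  shows "v \<bullet> (H *v u) = u \<bullet> (H *v v)"
  by (metis assms dot_lmul_matrix inner_commute transpose_matrix_vector)

lemma sym_pos_def_inner_eq_0_iff:
  assumes "sym_pos_def H"
  shows "v \<bullet> (H *v v) = 0 \<longleftrightarrow> v = 0"
  using assms unfolding sym_pos_def_def by force

text \<open>Around a critical point the objective grows by half the quadratic form of the
  displacement, which is positive.\<close>

lemma quad_minimizer_unique:
  assumes spd: "sym_pos_def H" and crit: "H *v x + b = 0"
    and min: "\<forall>y. quad H b xmin \<le> quad H b y"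
  shows "x = xmin"
proof (rule ccontr)
  assume "x \<noteq> xmin"
  define d where "d = xmin - x"
  have xmin: "xmin = x + d" and b: "b = - (H *v x)"
    using crit by (simp_all add: d_def eq_neg_iff_add_eq_0 add.commute)
  have "x \<bullet> (H *v d) = d \<bullet> (H *v x)"
    using spd by (simp add: sym_pos_def_def inner_matrix_vector_commute)
  then have "quad H b xmin = quad H b x + (d \<bullet> (H *v d)) / 2"
    unfolding quad_def xmin b
    by (simp add: matrix_vector_right_distrib inner_add_left inner_add_right
        inner_commute[of "H *v x"] field_simps)
  moreover have "0 < d \<bullet> (H *v d)"
    using spd \<open>x \<noteq> xmin\<close> by (auto simp: sym_pos_def_def d_def)
  ultimately show False
    using min[rule_format, of x] by simp
qed

text \<open>Turns steps of the iterates into a recursion on gradients alone.\<close>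

lemma grad_quad_step:
  assumes "transpose H = H"
  shows "grad (quad H b) (x - \<alpha> *\<^sub>R v) = grad (quad H b) x - \<alpha> *\<^sub>R (H *v v)"
  by (simp add: grad_quad[OF assms] matrix_vector_mult_diff_distrib matrix_vector_mult_scaleR)

text \<open>On an eigenvector the Cauchy stepsize is the reciprocal eigenvalue.\<close>

lemma cauchy_step_on_eigenvector:
  assumes "g \<noteq> 0" and "H *v g = m *\<^sub>R g" and "m \<noteq> 0"
  shows "g - sd_step H g *\<^sub>R (H *v g) = 0"
  using assms by (simp add: sd_step_def)

section \<open>Tridiagonal form of \<open>H\<close> after two Cauchy steps\<close>

locale two_cauchy_steps =
  fixes H :: "real ^ 3 ^ 3" and g0 g1 g2 :: "real ^ 3"
  assumes spd: "sym_pos_def H"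
    and g1: "g1 = g0 - sd_step H g0 *\<^sub>R (H *v g0)"
    and g2: "g2 = g1 - sd_step H g1 *\<^sub>R (H *v g1)"
    and distinct: "distinct [g0, g1, g2]"
    and indep: "independent {g0, g1, g2}"
begin

text \<open>\<open>a\<close>, \<open>b\<close>, \<open>c\<close> are the Rayleigh quotients of
  \<open>g0\<close>, \<open>g1\<close>, \<open>w\<close>, and \<open>\<kappa>\<close> is the
  Gram-Schmidt coefficient. \<open>r\<close> and \<open>s\<close> are the squared off-diagonal
  entries of \<open>H\<close> in the normalized basis; \<open>\<sigma>\<close> is the coupling of
  \<open>w\<close> to \<open>g1\<close>.\<close>

definition "a = 1 / sd_step H g0"
definition "b = 1 / sd_step H g1"
definition "c = ny_a33 H g0 g2"
definition "\<kappa> = (g2 \<bullet> g0) / (g0 \<bullet> g0)"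
definition "w = g2 - \<kappa> *\<^sub>R g0"
definition "\<sigma> = b * (w \<bullet> w) / (g1 \<bullet> g1)"
definition "r = ny_beta H g1 g2 * ny_gamma g0 g2"
definition "s = ny_beta H g1 g2 * (1 - ny_gamma g0 g2)"

abbreviation "t1 \<equiv> ny_t1 H g0 g1 g2"
abbreviation "t2 \<equiv> ny_t2 H g0 g1 g2"
abbreviation "t3 \<equiv> ny_t3 H g0 g1 g2"

lemma H_sym: "v \<bullet> (H *v u) = u \<bullet> (H *v v)"
  using spd by (simp add: sym_pos_def_def inner_matrix_vector_commute)

lemma H_pos: "v \<noteq> 0 \<Longrightarrow> 0 < v \<bullet> (H *v v)"
  using spd by (simp add: sym_pos_def_def)

lemma nonzero: "g0 \<noteq> 0" "g1 \<noteq> 0" "g2 \<noteq> 0"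
  using indep dependent_zero[of "{g0, g1, g2}"] by auto

lemma w_nonzero: "w \<noteq> 0"
proof
  assume "w = 0"
  then have "g2 = \<kappa> *\<^sub>R g0" by (simp add: w_def)
  then have "g2 \<in> span {g0, g1}" by (metis span_scale span_base insertI1)
  moreover have "{g0, g1, g2} - {g2} = {g0, g1}" using distinct by auto
  ultimately show False using indep unfolding dependent_def by force
qed

lemma span_eq_UNIV: "span {g0, g1, g2} = UNIV"
proof -
  have "card {g0, g1, g2} = 3" using distinct by simp
  then show ?thesis
    using card_ge_dim_independent[of "{g0, g1, g2}" UNIV] indep by auto
qed

lemma orthogonal_to_basis:
  assumes "d \<bullet> g0 = 0" "d \<bullet> g1 = 0" "d \<bullet> g2 = 0"
  shows "d = 0"
proof -
  have "orthogonal d d"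
    by (rule orthogonal_to_span[of d "{g0, g1, g2}"])
      (use assms in \<open>auto simp: span_eq_UNIV orthogonal_def\<close>)
  then show ?thesis by (simp add: orthogonal_self)
qed

lemma sd_step_pos: "v \<noteq> 0 \<Longrightarrow> 0 < sd_step H v"
  by (simp add: sd_step_def H_pos)

lemma a_pos: "0 < a" and b_pos: "0 < b"
  by (simp_all add: a_def b_def sd_step_pos nonzero)

lemma H_g0: "H *v g0 = a *\<^sub>R (g0 - g1)" and H_g1: "H *v g1 = b *\<^sub>R (g1 - g2)"
proof -
  have "g0 - g1 = sd_step H g0 *\<^sub>R (H *v g0)" "g1 - g2 = sd_step H g1 *\<^sub>R (H *v g1)"
    using g1 g2 by simp_all
  then show "H *v g0 = a *\<^sub>R (g0 - g1)" "H *v g1 = b *\<^sub>R (g1 - g2)"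
    using sd_step_pos[OF nonzero(1)] sd_step_pos[OF nonzero(2)]
    by (simp_all add: a_def b_def)
qed

lemma orth01: "g0 \<bullet> g1 = 0" and orth12: "g1 \<bullet> g2 = 0"
proof -
  have "g0 \<bullet> (g0 - sd_step H g0 *\<^sub>R (H *v g0)) = 0"
    using H_pos[OF nonzero(1)] by (simp add: sd_step_def inner_diff_right)
  then show "g0 \<bullet> g1 = 0" by (simp flip: g1)
  have "g1 \<bullet> (g1 - sd_step H g1 *\<^sub>R (H *v g1)) = 0"
    using H_pos[OF nonzero(2)] by (simp add: sd_step_def inner_diff_right)
  then show "g1 \<bullet> g2 = 0" by (simp flip: g2)
qed

lemma g2_eq: "g2 = w + \<kappa> *\<^sub>R g0"
  by (simp add: w_def)

lemma w_orth: "w \<bullet> g0 = 0" "w \<bullet> g1 = 0" "w \<bullet> g2 = w \<bullet> w"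
proof -
  show g0: "w \<bullet> g0 = 0" by (simp add: w_def \<kappa>_def inner_diff_left nonzero)
  show "w \<bullet> g1 = 0"
    by (simp add: w_def inner_diff_left orth01 orth12 inner_commute[of g2])
  have "w \<bullet> g2 = w \<bullet> (w + \<kappa> *\<^sub>R g0)"
    by (simp flip: g2_eq)
  then show "w \<bullet> g2 = w \<bullet> w"
    using g0 by (simp add: inner_add_right)
qed

text \<open>\<open>H *v g0\<close> lies in the span of \<open>g0\<close> and \<open>g1\<close>, both
  orthogonal to \<open>w\<close>: this is the zero corner of the tridiagonal matrix.\<close>

lemma w_H: "w \<bullet> (H *v g0) = 0" "w \<bullet> (H *v g1) = - b * (w \<bullet> w)"
  by (simp_all add: H_g0 H_g1 inner_diff_right w_orth)

lemma gamma_eq: "ny_gamma g0 g2 = \<kappa>\<^sup>2 * (g0 \<bullet> g0) / (g2 \<bullet> g2)"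
  unfolding ny_gamma_def \<kappa>_def power2_norm_eq_inner
  using nonzero by (simp add: power_divide power2_eq_square)

text \<open>\<open>ny_gamma g0 g2\<close> is the squared cosine of the angle between
  \<open>g0\<close> and \<open>g2\<close>; Pythagoras gives the squared sine.\<close>

lemma one_minus_gamma_eq: "1 - ny_gamma g0 g2 = (w \<bullet> w) / (g2 \<bullet> g2)"
proof -
  have "g2 \<bullet> g2 = (w + \<kappa> *\<^sub>R g0) \<bullet> (w + \<kappa> *\<^sub>R g0)"
    by (simp flip: g2_eq)
  also have "\<dots> = w \<bullet> w + \<kappa>\<^sup>2 * (g0 \<bullet> g0)"
    using w_orth(1)
    by (simp add: inner_add_left inner_add_right inner_commute[of g0 w] power2_eq_square)
  finally have "w \<bullet> w = g2 \<bullet> g2 - \<kappa>\<^sup>2 * (g0 \<bullet> g0)"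
    by simp
  then show ?thesis
    using nonzero by (simp add: gamma_eq diff_divide_distrib)
qed

lemma beta_eq: "ny_beta H g1 g2 = b\<^sup>2 * (g2 \<bullet> g2) / (g1 \<bullet> g1)"
  by (simp add: ny_beta_def b_def power2_norm_eq_inner power_divide)

lemma r_nonneg: "0 \<le> r" and s_pos: "0 < s"
  using nonzero b_pos w_nonzero
  by (simp add: r_def beta_eq gamma_eq, simp add: s_def beta_eq one_minus_gamma_eq)

lemma s_eq: "s = b * \<sigma>"
  using nonzero by (simp add: s_def beta_eq one_minus_gamma_eq \<sigma>_def power2_eq_square)

text \<open>Symmetry of \<open>H\<close> on \<open>g0\<close>, \<open>g1\<close> trades one factor
  \<open>\<kappa>\<close> for \<open>a\<close>. The result is the product of the opposite entries
  \<open>- a\<close> and \<open>- b * \<kappa>\<close> in the unnormalized basis.\<close>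

lemma r_eq: "r = a * b * \<kappa>"
proof -
  have "g1 \<bullet> (H *v g0) = g0 \<bullet> (H *v g1)" by (rule H_sym)
  then have "a * (g1 \<bullet> g1) = b * (g2 \<bullet> g0)"
    by (simp add: H_g0 H_g1 inner_diff_right orth01 inner_commute[of g1 g0] inner_commute[of g0 g2])
  then have "a * (g1 \<bullet> g1) = b * \<kappa> * (g0 \<bullet> g0)"
    using nonzero by (simp add: \<kappa>_def)
  moreover have "r = b\<^sup>2 * \<kappa>\<^sup>2 * (g0 \<bullet> g0) / (g1 \<bullet> g1)"
    using nonzero by (simp add: r_def beta_eq gamma_eq)
  ultimately have "r * (g1 \<bullet> g1) = a * b * \<kappa> * (g1 \<bullet> g1)"
    using nonzero by (simp add: power2_eq_square)
  then show ?thesis using nonzero by simp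
qed

text \<open>In \<open>g2 \<bullet> (H *v g2)\<close> the cross terms vanish by \<open>w_H\<close>;
  \<open>ny_a33\<close> subtracts the share of \<open>g0\<close> and renormalizes.\<close>

lemma c_eq: "c = (w \<bullet> (H *v w)) / (w \<bullet> w)"
proof -
  have "g2 \<bullet> (H *v g2) = (w + \<kappa> *\<^sub>R g0) \<bullet> (H *v (w + \<kappa> *\<^sub>R g0))"
    by (simp flip: g2_eq)
  also have "\<dots> = w \<bullet> (H *v w) + \<kappa>\<^sup>2 * (g0 \<bullet> (H *v g0))"
    using w_H(1) H_sym[of g0 w]
    by (simp add: inner_add_left inner_add_right matrix_vector_right_distrib
        matrix_vector_mult_scaleR power2_eq_square)
  finally have "g2 \<bullet> (H *v g2) = w \<bullet> (H *v w) + \<kappa>\<^sup>2 * (g0 \<bullet> (H *v g0))" .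
  moreover have "g0 \<bullet> (H *v g0) = a * (g0 \<bullet> g0)"
    by (simp add: H_g0 inner_diff_right orth01)
  ultimately have "1 / sd_step H g2 - a * ny_gamma g0 g2 = (w \<bullet> (H *v w)) / (g2 \<bullet> g2)"
    using nonzero by (simp add: sd_step_def gamma_eq field_simps)
  then show ?thesis
    using nonzero by (simp add: c_def ny_a33_def one_minus_gamma_eq a_def)
qed

text \<open>The difference of the two sides is orthogonal to \<open>g0\<close>, \<open>g1\<close>
  and \<open>w\<close>, hence to a basis.\<close>

lemma H_w: "H *v w = c *\<^sub>R w - \<sigma> *\<^sub>R g1"
proof -
  define d where "d = H *v w - c *\<^sub>R w + \<sigma> *\<^sub>R g1"
  have swap: "(H *v w) \<bullet> v = w \<bullet> (H *v v)" for v
    by (metis H_sym inner_commute)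
  have d0: "d \<bullet> g0 = 0"
    by (simp add: d_def inner_diff_left inner_add_left swap w_H w_orth orth01 inner_commute[of g1])
  have "d \<bullet> g1 = 0"
    using nonzero
    by (simp add: d_def inner_diff_left inner_add_left swap w_H w_orth \<sigma>_def)
  moreover have "d \<bullet> w = 0"
    using w_nonzero w_orth(2)
    by (simp add: d_def inner_diff_left inner_add_left c_eq inner_commute[of g1] swap)
  moreover have "d \<bullet> g2 = d \<bullet> w + \<kappa> * (d \<bullet> g0)"
    using inner_add_right[of d w "\<kappa> *\<^sub>R g0"] by (simp flip: g2_eq)
  ultimately have "d = 0"
    using d0 by (intro orthogonal_to_basis) simp_all
  then show ?thesis by (simp add: d_def algebra_simps add_eq_0_iff2)
qed

section \<open>Characteristic polynomial and the final eigenvector\<close>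

lemma t_eqs:
  "t1 = a + b + c" "t2 = a * b + a * c + b * c - r - s" "t3 = a * b * c - a * s - c * r"
  by (simp_all add: ny_t1_def ny_t2_def ny_t3_def a_def b_def c_def r_def s_def algebra_simps
      divide_simps)

definition char_map :: "real ^ 3 \<Rightarrow> real ^ 3" where
  "char_map v = H *v (H *v (H *v v)) - t1 *\<^sub>R (H *v (H *v v)) + t2 *\<^sub>R (H *v v) - t3 *\<^sub>R v"

lemmas H_linear = matrix_vector_right_distrib matrix_vector_mult_diff_distrib
  matrix_vector_mult_scaleR

text \<open>A polynomial in \<open>H\<close> commutes with \<open>H\<close>, so its vanishing passes
  from each gradient to the next.\<close>

lemma char_map_step: "char_map (v - \<alpha> *\<^sub>R (H *v v)) = char_map v - \<alpha> *\<^sub>R (H *v char_map v)"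
  by (simp add: char_map_def H_linear algebra_simps)

lemma H2_g0: "H *v (H *v g0) = a *\<^sub>R (a *\<^sub>R (g0 - g1) - b *\<^sub>R (g1 - g2))"
  by (simp add: H_g0 H_g1 H_linear)

text \<open>In the orthogonal basis \<open>g0\<close>, \<open>g1\<close>, \<open>w\<close> the matrix is tridiagonal, so this is the
  Cayley--Hamilton theorem.\<close>

lemma char_map_g0: "char_map g0 = 0"
proof -
  have H1: "H *v g1 = b *\<^sub>R g1 - b *\<^sub>R w - (b * \<kappa>) *\<^sub>R g0"
    using H_g1 arg_cong[OF g2_eq, of "\<lambda>v. b *\<^sub>R v"] by (simp add: algebra_simps)
  have 1: "H *v g0 = a *\<^sub>R g0 - a *\<^sub>R g1"
    by (simp add: H_g0 algebra_simps)
  have 2: "H *v (H *v g0) = (a * a + r) *\<^sub>R g0 - (a * (a + b)) *\<^sub>R g1 + (a * b) *\<^sub>R w"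
    by (simp add: 1 H1 H_linear r_eq algebra_simps)
  have 3: "H *v (H *v (H *v g0)) =
      ((a * a + r) * a + (a + b) * r) *\<^sub>R g0
      - ((a * a + r) * a + a * (a + b) * b + a * s) *\<^sub>R g1
      + (a * (a + b) * b + a * b * c) *\<^sub>R w"
    by (simp only: 2 H_linear 1 H1 H_w) (simp add: vec_eq_iff r_eq s_eq algebra_simps)
  show ?thesis
    unfolding char_map_def 3 unfolding 2 unfolding 1 t_eqs
    by (simp add: vec_eq_iff algebra_simps)
qed

lemma char_map_g2: "char_map g2 = 0"
proof -
  have "char_map (g0 - sd_step H g0 *\<^sub>R (H *v g0)) = 0"
    by (simp add: char_map_step char_map_g0)
  then have "char_map g1 = 0"
    by (simp flip: g1)
  then have "char_map (g1 - sd_step H g1 *\<^sub>R (H *v g1)) = 0"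
    by (simp add: char_map_step)
  then show ?thesis
    by (simp flip: g2)
qed

text \<open>Otherwise injectivity of \<open>H\<close> would cancel one factor and leave a quadratic
  in \<open>H\<close> killing \<open>g0\<close>; but \<open>H *v (H *v g0)\<close> has the nonzero
  coefficient \<open>a * b\<close> along \<open>w\<close>. Hence no \<open>ny_mu\<close>
  vanishes.\<close>

lemma t3_nonzero: "t3 \<noteq> 0"
proof
  assume "t3 = 0"
  define v where "v = H *v (H *v g0) - t1 *\<^sub>R (H *v g0) + t2 *\<^sub>R g0"
  have "H *v v = 0"
    using char_map_g0 \<open>t3 = 0\<close> by (simp add: v_def char_map_def H_linear)
  then have "v = 0"
    using sym_pos_def_inner_eq_0_iff[OF spd, of v] by simp
  then have "w \<bullet> v = 0" by simp
  then have "a * b * (w \<bullet> w) = 0"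
    by (simp add: v_def H2_g0 w_H inner_diff_right inner_add_right w_orth)
  then show False using a_pos b_pos w_nonzero by simp
qed

lemma ny_mu_vieta:
  defines "m \<equiv> ny_mu H g0 g1 g2"
  shows "m 1 + m 2 + m 3 = t1" "m 1 * m 2 + m 1 * m 3 + m 2 * m 3 = t2" "m 1 * m 2 * m 3 = t3"
proof -
  have rs: "0 \<le> s" "0 < r + s" using r_nonneg s_pos by simp_all
  note vieta = jacobi_cubic_trig_roots[OF r_nonneg rs, of a b c, folded t_eqs,
      folded ny_p_def ny_q_def, folded ny_phi_def]
  show "m 1 + m 2 + m 3 = t1" "m 1 * m 2 + m 1 * m 3 + m 2 * m 3 = t2" "m 1 * m 2 * m 3 = t3"
    using vieta by (simp_all add: m_def ny_mu_def)
qed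

text \<open>Up to a scalar factor, \<open>g4\<close> is obtained from \<open>g2\<close> by applying two of the three
  linear factors of the characteristic polynomial; the third one annihilates it.\<close>

lemma eigenvector_after_two_steps:
  assumes ij: "i \<in> {1, 2, 3}" "j \<in> {1, 2, 3}" "i \<noteq> j"
    and g3: "g3 = g2 - ny_step H g0 g1 g2 i *\<^sub>R (H *v g2)"
    and g4: "g4 = g3 - ny_step H g0 g1 g2 j *\<^sub>R (H *v g3)"
  obtains m where "m \<noteq> 0" "H *v g4 = m *\<^sub>R g4"
proof -
  define mi mj where "mi = ny_mu H g0 g1 g2 i" and "mj = ny_mu H g0 g1 g2 j"
  obtain m where sums: "mi + mj + m = t1" "mi * mj + mi * m + mj * m = t2" "mi * mj * m = t3"
  proof (rule that)
    \<comment> \<open>The remaining index, as 1 + 2 + 3 = 6.\<close>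
    let ?k = "6 - i - j"
    show "mi + mj + ny_mu H g0 g1 g2 ?k = t1"
      "mi * mj + mi * ny_mu H g0 g1 g2 ?k + mj * ny_mu H g0 g1 g2 ?k = t2"
      "mi * mj * ny_mu H g0 g1 g2 ?k = t3"
      using ij ny_mu_vieta unfolding mi_def mj_def by (auto simp: algebra_simps)
  qed
  then have nz: "mi \<noteq> 0" "mj \<noteq> 0" "m \<noteq> 0" using t3_nonzero by auto
  define D where "D = (\<lambda>m v. H *v v - m *\<^sub>R v)"
  have D_scale: "D m (k *\<^sub>R v) = k *\<^sub>R D m v" for m k v
    by (simp add: D_def H_linear algebra_simps)
  \<comment> \<open>The factor in \<open>g - inverse \<mu> *\<^sub>R (H *v g) = - inverse \<mu>
    *\<^sub>R (H *v g - \<mu> *\<^sub>R g)\<close>, valid for nonzero \<open>\<mu>\<close>.\<close>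
  define ki kj where "ki = - inverse mi" and "kj = - inverse mj"
  have "g3 = ki *\<^sub>R D mi g2" "g4 = kj *\<^sub>R D mj g3"
    using nz by (simp_all add: g3 g4 D_def ny_step_def flip: mi_def mj_def)
      (simp_all add: ki_def kj_def algebra_simps)
  then have "D m g4 = (kj * ki) *\<^sub>R D m (D mj (D mi g2))"
    by (simp add: D_scale)
  also have "D m (D mj (D mi g2)) = char_map g2"
    unfolding D_def char_map_def sums[symmetric] by (simp add: H_linear algebra_simps)
  finally have "H *v g4 = m *\<^sub>R g4" by (simp add: char_map_g2 D_def)
  then show ?thesis using that nz by blast
qed

end

theorem mainTheorem1:
  fixes H :: "real ^ 3 ^ 3"
    and b xmin x0 x1 x2 x3 x4 g0 g1 g2 g3 g4 :: "real ^ 3"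
    and i j :: nat
  assumes "sym_pos_def H"
    and "\<forall>y. quad H b xmin \<le> quad H b y"
    and "g0 = grad (quad H b) x0"
    and "g1 = grad (quad H b) x1"
    and "g2 = grad (quad H b) x2"
    and "g3 = grad (quad H b) x3"
    and "g4 = grad (quad H b) x4"
    and "x1 = x0 - sd_step H g0 *\<^sub>R g0"
    and "x2 = x1 - sd_step H g1 *\<^sub>R g1"
    and "distinct [g0, g1, g2]" and "independent {g0, g1, g2}"
    and "i \<in> {1, 2, 3}" and "j \<in> {1, 2, 3}" and "i \<noteq> j"
    and "x3 = x2 - ny_step H g0 g1 g2 i *\<^sub>R g2"
    and "x4 = x3 - ny_step H g0 g1 g2 j *\<^sub>R g3"
  shows "(g4 = 0 \<and> x4 = xmin) \<or> (g4 \<noteq> 0 \<and> x4 - sd_step H g4 *\<^sub>R g4 = xmin)"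
proof -
  have sym: "transpose H = H" using assms(1) by (simp add: sym_pos_def_def)
  note step = grad_quad_step[OF sym]
  have g1: "g1 = g0 - sd_step H g0 *\<^sub>R (H *v g0)"
    and g2: "g2 = g1 - sd_step H g1 *\<^sub>R (H *v g1)"
    and g3: "g3 = g2 - ny_step H g0 g1 g2 i *\<^sub>R (H *v g2)"
    and g4: "g4 = g3 - ny_step H g0 g1 g2 j *\<^sub>R (H *v g3)"
    using assms(3-9,15,16) step by simp_all
  interpret two_cauchy_steps H g0 g1 g2
    using assms(1,10,11) g1 g2 by unfold_locales
  obtain m where m: "m \<noteq> 0" "H *v g4 = m *\<^sub>R g4"
    using eigenvector_after_two_steps[OF assms(12-14) g3 g4] .
  have critical: "x = xmin" if "grad (quad H b) x = 0" for x
    using quad_minimizer_unique[OF assms(1) _ assms(2)] that by (simp add: grad_quad[OF sym])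
  show ?thesis
  proof (cases "g4 = 0")
    case True
    then show ?thesis using critical assms(7) by simp
  next
    case False
    have "grad (quad H b) (x4 - sd_step H g4 *\<^sub>R g4) = 0"
      using cauchy_step_on_eigenvector[OF False m(2,1)] step assms(7) by simp
    then show ?thesis using False critical by blast
  qed
qed

end
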